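(* Let $\mathbb{F}_q$ be a finite field, $k\ge 1$, and let $M$ be a trail of level $k$ (so $\nu_M$ assigns exactly $x_1\mapsto\alpha_1,\dots,x_{k-1}\mapsto\alpha_{k-1}$, and we write $\boldsymbol{\alpha}_M=(\alpha_1,\dots,\alpha_{k-1})\in\mathbb{F}_q^{k-1}$). Let $f$ be a polynomial constraint with polynomial in $\mathbb{F}_q[x_1,\dots,x_k]$ such that $f\notin\mathrm{constraints}(M)$ and $\lnot f$ is not compatible with $M$. Let $$A=\{f'\in\mathrm{constraints}(M)\mid \mathrm{level}(f')=k\}\cup\{\lnot f\},$$ let $A_{=}=\{p\mid (p=0)\in A\}$ and $A_{\neq}=\{p\mid (p\neq 0)\in A\}$. Let $\Delta=\{(P_1,Q_1),\dots,(P_r,Q_r)\}$ be a weak projecting zero decomposition of $(A_{=},A_{\neq})$ for $\boldsymbol{\alpha}_M$. For each $1\le \ell\le r$ choose a polynomial $u_\ell\in\mathbb{F}_q[x_1,\dots,x_{k-1}]$ with either $u_\ell\in P_\ell$ and $u_\ell(\boldsymbol{\alpha}_M)\neq 0$, in which case set $c_\ell$ to be the constraint $u_\ell=0$, or $u_\ell\in Q_\ell$ and $u_\ell(\boldsymbol{\alpha}_M)=0$, in which case set $c_\ell$ to be the constraint $u_\ell\neq 0$. Let $C=\{c_1,\dots,c_r\}$. Then the clause $E=\{\lnot a\mid a\in A\}\cup C$ is an explanation clause for $f$ in $M$.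
   Context: Variables $x_1<x_2<\dots<x_n$; $X_k=\{x_1,\dots,x_k\}$. A polynomial constraint is $p=0$ or $p\neq 0$ with $p\in\mathbb{F}_q[x_1,\dots,x_n]$; its negation swaps $=$ and $\neq$. The level of a constraint is the largest $i$ such that $x_i$ occurs in its polynomial. An assignment $\nu$ satisfies $p\vartriangleright 0$ if $\nu(p)\vartriangleright 0$; a clause (set of constraints, read as a disjunction) is satisfied if some member is. A trail $M$ is a sequence whose elements are polynomial constraints (literals) or variable assignments $x_i\mapsto\alpha\in\mathbb{F}_q$; $\mathrm{constraints}(M)$ is the set of constraints on $M$; $M$ has level $k$ if its variable assignments are exactly $x_1\mapsto\alpha_1,\dots,x_{k-1}\mapsto\alpha_{k-1}$, giving the partial assignment $\nu_M$; all constraints on $M$ have polynomials in $\mathbb{F}_q[X_k]$. For a constraint $g$ with polynomial in $\mathbb{F}_q[X_k]$: $\mathrm{value}(g,M)=\nu_M(g)$ if $x_k$ does not occur in $g$; $=\mathrm{true}$ if $g\in\mathrm{constraints}(M)$; $=\mathrm{false}$ if $\lnot g\in\mathrm{constraints}(M)$; undefined otherwise. $\mathrm{feasible}(g,M)$ is the set of $\beta\in\mathbb{F}_q$ such that the extension of $\nu_M$ by $x_k\mapsto\beta$ satisfies $g$ and all constraints of $M$; $g$ is compatible with $M$ if this set is nonempty. A clause $E$ is a valid lemma if no total assignment $\nu:\{x_1,\dots,x_n\}\to\mathbb{F}_q$ makes $E$ false; $E$ justifies $f$ in $M$ if $f\in E$ and $\mathrm{value}(f',M)=\mathrm{false}$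 for every $f'\in E$ with $f'\neq f$; $E$ is an explanation clause for $f$ in $M$ if it is a valid lemma and justifies $f$ in $M$. For finite $P,Q\subset\mathbb{F}_q[X_k]$, $\mathrm{zero}_q(P/Q)=\{\boldsymbol{\xi}\in\mathbb{F}_q^k\mid p(\boldsymbol{\xi})=0\ \forall p\in P,\ q(\boldsymbol{\xi})\neq 0\ \forall q\in Q\}$ and $\mathrm{proj}_k\mathrm{zero}_q(P/Q)=\{\boldsymbol{\alpha}\in\mathbb{F}_q^{k-1}\mid\exists\beta\in\mathbb{F}_q:(\boldsymbol{\alpha},\beta)\in\mathrm{zero}_q(P/Q)\}$. Given $\boldsymbol{\alpha}\in\mathbb{F}_q^{k-1}$ such that no $\beta\in\mathbb{F}_q$ has $(\boldsymbol{\alpha},\beta)\in\mathrm{zero}_q(P/Q)$, a weak projecting zero decomposition of $(P,Q)$ for $\boldsymbol{\alpha}$ is a finite set $\Delta$ of pairs $(P',Q')$ of finite subsets of $\mathbb{F}_q[X_{k-1}]$ such that $\mathrm{proj}_k\mathrm{zero}_q(P/Q)\subseteq\bigcup_{(P',Q')\in\Delta}\mathrm{zero}_q(P'/Q')$ and $\boldsymbol{\alpha}\notin\mathrm{zero}_q(P'/Q')$ for all $(P',Q')\in\Delta$. *)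

theory Defs
  imports "HOL-Library.Poly_Mapping" "HOL-Library.FuncSet"
begin

(* Polynomials in x_1, x_2, ...: finitely supported maps from monomials to coefficients, where a
   monomial is a finitely supported map from variable indices to exponents. *)
type_synonym 'a mpoly = "(nat \<Rightarrow>\<^sub>0 nat) \<Rightarrow>\<^sub>0 'a"

definition vars :: "'a::zero mpoly \<Rightarrow> nat set" where
  "vars p = (\<Union>m\<in>Poly_Mapping.keys p. Poly_Mapping.keys m)"

definition eval :: "(nat \<Rightarrow> 'a) \<Rightarrow> 'a::comm_semiring_1 mpoly \<Rightarrow> 'a" where
  "eval \<nu> p = (\<Sum>m\<in>Poly_Mapping.keys p. Poly_Mapping.lookup p m *
     (\<Prod>i\<in>Poly_Mapping.keys m. \<nu> i ^ Poly_Mapping.lookup m i))"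

(* The ring of polynomials in x_1, ..., x_k. *)
definition polys :: "nat \<Rightarrow> 'a::zero mpoly set" where
  "polys k = {p. vars p \<subseteq> {1..k}}"

(* The affine space of dimension k: the coordinate of x_i is the value at i, for 1 <= i <= k.
   Extending a point a of dimension k - 1 by a last coordinate b is a(k := b). *)
definition points :: "nat \<Rightarrow> (nat \<Rightarrow> 'a) set" where
  "points k = {1..k} \<rightarrow>\<^sub>E UNIV"

(* The datatypes are parametric in the type of polynomials and of constraints because the type of
   poly_mappings depends on the zero of its coefficients. *)
datatype 'p zero_constraint = EqZ 'p | NeqZ 'p

type_synonym 'a pconstraint = "'a mpoly zero_constraint"

primrec pol :: "'a::zero pconstraint \<Rightarrow> 'a mpoly" where
  "pol (EqZ p) = p"
| "pol (NeqZ p) = p"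

primrec neg :: "'a::zero pconstraint \<Rightarrow> 'a pconstraint" where
  "neg (EqZ p) = NeqZ p"
| "neg (NeqZ p) = EqZ p"

primrec sat :: "(nat \<Rightarrow> 'a) \<Rightarrow> 'a::comm_semiring_1 pconstraint \<Rightarrow> bool" where
  "sat \<nu> (EqZ p) \<longleftrightarrow> eval \<nu> p = 0"
| "sat \<nu> (NeqZ p) \<longleftrightarrow> eval \<nu> p \<noteq> 0"

(* Constraints with a constant polynomial get level 0. *)
definition level :: "'a::zero pconstraint \<Rightarrow> nat" where
  "level c = Max (insert 0 (vars (pol c)))"

datatype ('c, 'a) trail_elem = Lit 'c | Assign nat 'a

type_synonym 'a trail = "('a pconstraint, 'a) trail_elem list"

definition constraints :: "'a::zero trail \<Rightarrow> 'a pconstraint set" where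
  "constraints M = {c. Lit c \<in> set M}"

definition assignments :: "'a::zero trail \<Rightarrow> (nat \<times> 'a) set" where
  "assignments M = {(i, a). Assign i a \<in> set M}"

definition trail_of_level :: "nat \<Rightarrow> 'a::zero trail \<Rightarrow> bool" where
  "trail_of_level k M \<longleftrightarrow>
     (\<exists>\<alpha>. assignments M = {(i, \<alpha> i) | i. i \<in> {1..k - 1}}) \<and>
     (\<forall>c\<in>constraints M. pol c \<in> polys k)"

(* For a trail of level k this is a point of dimension k - 1. *)
definition trail_asg :: "'a::zero trail \<Rightarrow> nat \<Rightarrow> 'a" where
  "trail_asg M = (\<lambda>i\<in>fst ` assignments M. THE a. (i, a) \<in> assignments M)"

(* The value of a constraint with respect to a trail of level k. The two last rules overlap when the
   trail contains both a constraint and its negation, so the value is a relation; it is a partial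
   function on all other trails, and an undefined value is one that is not related to anything. *)
inductive has_value :: "nat \<Rightarrow> 'a::comm_semiring_1 trail \<Rightarrow> 'a pconstraint \<Rightarrow> bool \<Rightarrow> bool"
  for k :: nat and M :: "'a trail" where
  evaluated: "pol g \<in> polys k \<Longrightarrow> k \<notin> vars (pol g) \<Longrightarrow> has_value k M g (sat (trail_asg M) g)"
| asserted: "pol g \<in> polys k \<Longrightarrow> k \<in> vars (pol g) \<Longrightarrow> g \<in> constraints M \<Longrightarrow> has_value k M g True"
| refuted: "pol g \<in> polys k \<Longrightarrow> k \<in> vars (pol g) \<Longrightarrow> neg g \<in> constraints M \<Longrightarrow> has_value k M g False"

lemma has_value_unique:
  assumes "\<And>c. c \<in> constraints M \<Longrightarrow> neg c \<notin> constraints M"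
    and "has_value k M g b" "has_value k M g b'"
  shows "b = b'"
  using assms(2,3) assms(1)[of g] by (auto elim!: has_value.cases)

definition feasible :: "nat \<Rightarrow> 'a::comm_semiring_1 pconstraint \<Rightarrow> 'a trail \<Rightarrow> 'a set" where
  "feasible k g M = {\<beta>. sat ((trail_asg M)(k := \<beta>)) g \<and>
     (\<forall>c\<in>constraints M. sat ((trail_asg M)(k := \<beta>)) c)}"

definition compatible :: "nat \<Rightarrow> 'a::comm_semiring_1 pconstraint \<Rightarrow> 'a trail \<Rightarrow> bool" where
  "compatible k g M \<longleftrightarrow> feasible k g M \<noteq> {}"

definition clause :: "nat \<Rightarrow> 'a::zero pconstraint set \<Rightarrow> bool" where
  "clause n E \<longleftrightarrow> (\<forall>c\<in>E. pol c \<in> polys n)"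

definition valid_lemma :: "nat \<Rightarrow> 'a::comm_semiring_1 pconstraint set \<Rightarrow> bool" where
  "valid_lemma n E \<longleftrightarrow> clause n E \<and> \<not> (\<exists>\<nu>\<in>points n. \<forall>c\<in>E. \<not> sat \<nu> c)"

definition justifies ::
    "nat \<Rightarrow> 'a::comm_semiring_1 pconstraint set \<Rightarrow> 'a pconstraint \<Rightarrow> 'a trail \<Rightarrow> bool" where
  "justifies k E f M \<longleftrightarrow> f \<in> E \<and> (\<forall>f'\<in>E. f' \<noteq> f \<longrightarrow> has_value k M f' False)"

definition explanation_clause ::
    "nat \<Rightarrow> nat \<Rightarrow> 'a::comm_semiring_1 pconstraint set \<Rightarrow> 'a pconstraint \<Rightarrow> 'a trail \<Rightarrow> bool" where
  "explanation_clause n k E f M \<longleftrightarrow> valid_lemma n E \<and> justifies k E f M"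

definition zero_set ::
    "nat \<Rightarrow> 'a::comm_semiring_1 mpoly set \<Rightarrow> 'a mpoly set \<Rightarrow> (nat \<Rightarrow> 'a) set" where
  "zero_set k P Q = {\<xi>\<in>points k. (\<forall>p\<in>P. eval \<xi> p = 0) \<and> (\<forall>q\<in>Q. eval \<xi> q \<noteq> 0)}"

definition proj_zero_set ::
    "nat \<Rightarrow> 'a::comm_semiring_1 mpoly set \<Rightarrow> 'a mpoly set \<Rightarrow> (nat \<Rightarrow> 'a) set" where
  "proj_zero_set k P Q = {\<alpha>\<in>points (k - 1). \<exists>\<beta>. \<alpha>(k := \<beta>) \<in> zero_set k P Q}"

definition weak_proj_zero_decomp ::
    "nat \<Rightarrow> 'a::comm_semiring_1 mpoly set \<Rightarrow> 'a mpoly set \<Rightarrow> (nat \<Rightarrow> 'a) \<Rightarrow>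
     ('a mpoly set \<times> 'a mpoly set) set \<Rightarrow> bool" where
  "weak_proj_zero_decomp k P Q \<alpha> \<Delta> \<longleftrightarrow>
     finite P \<and> finite Q \<and> P \<subseteq> polys k \<and> Q \<subseteq> polys k \<and>
     \<alpha> \<in> points (k - 1) \<and> \<not> (\<exists>\<beta>. \<alpha>(k := \<beta>) \<in> zero_set k P Q) \<and>
     finite \<Delta> \<and>
     (\<forall>(P', Q')\<in>\<Delta>. finite P' \<and> finite Q' \<and> P' \<subseteq> polys (k - 1) \<and> Q' \<subseteq> polys (k - 1)) \<and>
     proj_zero_set k P Q \<subseteq> (\<Union>(P', Q')\<in>\<Delta>. zero_set (k - 1) P' Q') \<and>
     (\<forall>(P', Q')\<in>\<Delta>. \<alpha> \<notin> zero_set (k - 1) P' Q')"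

end

(* Every literal of E other than f is false on M: negations of level-k trail constraints are refuted by
   the trail, and each c_l is falsified by the partial assignment by choice of u_l. For validity, a total
   assignment falsifying E satisfies all of A, so its restriction to x_1, ..., x_{k-1} lies in the
   projection and hence in some zero set of (P_l, Q_l), which makes the corresponding c_l true. *)
theory Submission
  imports Defs
begin

lemma pol_neg [simp]: "pol (neg c) = pol c"
  by (cases c) auto

lemma neg_neg [simp]: "neg (neg c) = c"
  by (cases c) auto

lemma sat_neg [simp]: "sat \<nu> (neg c) \<longleftrightarrow> \<not> sat \<nu> c"
  by (cases c) auto

lemma finite_vars [simp]: "finite (vars p)"
  by (simp add: vars_def)

lemma polys_mono: "j \<le> k \<Longrightarrow> polys j \<subseteq> polys k"
  by (fastforce simp: polys_def)

lemma eval_cong: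
  assumes "\<And>i. i \<in> vars p \<Longrightarrow> \<nu> i = \<mu> i"
  shows "eval \<nu> p = eval \<mu> p"
proof -
  have "\<nu> i = \<mu> i" if "m \<in> Poly_Mapping.keys p" "i \<in> Poly_Mapping.keys m" for m i
    using assms that by (auto simp: vars_def)
  then show ?thesis
    by (simp add: eval_def)
qed

text \<open>Points of dimension \<open>k\<close> are \<open>undefined\<close> outside
  \<open>{1..k}\<close>. This lets an assignment be cut down to such a point without changing the
  value of a polynomial in x_1, ..., x_k.\<close>

lemma eval_restrict: "p \<in> polys k \<Longrightarrow> eval (restrict \<nu> {1..k}) p = eval \<nu> p"
  by (rule eval_cong) (auto simp: polys_def)

text \<open>Since \<open>k\<close> is positive, the maximum in \<open>level\<close> is not the
  inserted 0, so it is the index of a variable that occurs.\<close>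

lemma level_in_vars:
  assumes "level c = k" "1 \<le> k"
  shows "k \<in> vars (pol c)"
  using Max_in[of "insert 0 (vars (pol c))"] assms by (auto simp: level_def)

theorem theorem1:
  fixes n k r :: nat
    and M :: "'a::{field,finite} trail"
    and f :: "'a pconstraint"
    and A C E :: "'a pconstraint set"
    and P Q :: "nat \<Rightarrow> 'a mpoly set"
    and u :: "nat \<Rightarrow> 'a mpoly"
    and c :: "nat \<Rightarrow> 'a pconstraint"
  assumes "1 \<le> k" and "k \<le> n"
    and "trail_of_level k M"
    and "pol f \<in> polys k"
    and "f \<notin> constraints M"
    and "\<not> compatible k (neg f) M"
    and "A = {f' \<in> constraints M. level f' = k} \<union> {neg f}"
    and "weak_proj_zero_decomp k {p. EqZ p \<in> A} {p. NeqZ p \<in> A} (trail_asg M)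
           {(P l, Q l) | l. l \<in> {1..r}}"
    and "\<forall>l\<in>{1..r}. u l \<in> polys (k - 1) \<and>
           ((u l \<in> P l \<and> eval (trail_asg M) (u l) \<noteq> 0 \<and> c l = EqZ (u l)) \<or>
            (u l \<in> Q l \<and> eval (trail_asg M) (u l) = 0 \<and> c l = NeqZ (u l)))"
    and "C = {c l | l. l \<in> {1..r}}"
    and "E = {neg a | a. a \<in> A} \<union> C"
  shows "explanation_clause n k E f M"
proof -
  let ?\<alpha> = "trail_asg M"
  note f_in = assms(4) and A = assms(7) and W = assms(8) and E = assms(11)
  have M_polys: "pol g \<in> polys k" if "g \<in> constraints M" for g
    using assms(3) that by (auto simp: trail_of_level_def)
  have A_polys: "pol a \<in> polys k" if "a \<in> A" for a
    using that A M_polys f_in by auto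
  have E_cases: "g \<in> E \<longleftrightarrow> (\<exists>a\<in>A. g = neg a) \<or> (\<exists>l\<in>{1..r}. g = c l)" for g
    using assms(10) E by auto
  have c_polys: "pol (c l) \<in> polys (k - 1)" if "l \<in> {1..r}" for l
    using assms(9) that by fastforce
  have clause: "clause n E"
    unfolding clause_def
  proof
    fix g assume "g \<in> E"
    then have "pol g \<in> polys k"
      using A_polys c_polys polys_mono[of "k - 1" k] by (fastforce simp: E_cases)
    then show "pol g \<in> polys n"
      using polys_mono[OF \<open>k \<le> n\<close>] by auto
  qed
  have valid: False if \<nu>: "\<forall>g\<in>E. \<not> sat \<nu> g" for \<nu>
  proof -
    let ?\<beta> = "restrict \<nu> {1..k - 1}"
    have sat_A: "sat \<nu> a" if "a \<in> A" for a
      using \<nu> that by (force simp: E_cases)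
    \<comment> \<open>The coordinate lost in \<open>?\<beta>\<close> is put back as
      \<open>\<nu> k\<close>, the witness for membership in the projection. For \<open>k = 0\<close>
      the two sides could differ.\<close>
    have "?\<beta>(k := \<nu> k) = restrict \<nu> {1..k}"
      using \<open>1 \<le> k\<close> by (auto simp: fun_eq_iff restrict_def)
    moreover have "restrict \<nu> {1..k} \<in> zero_set k {p. EqZ p \<in> A} {p. NeqZ p \<in> A}"
      using sat_A A_polys eval_restrict[of _ k \<nu>] by (fastforce simp: zero_set_def points_def)
    ultimately have "?\<beta> \<in> proj_zero_set k {p. EqZ p \<in> A} {p. NeqZ p \<in> A}"
      unfolding proj_zero_set_def points_def by (auto intro!: exI[of _ "\<nu> k"])
    then obtain l where l: "l \<in> {1..r}" and zero: "?\<beta> \<in> zero_set (k - 1) (P l) (Q l)"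
      using W unfolding weak_proj_zero_decomp_def by blast
    have "u l \<in> polys (k - 1)"
      using assms(9) l by blast
    \<comment> \<open>At \<open>?\<beta>\<close> members of \<open>P l\<close> vanish and members of
      \<open>Q l\<close> do not, so either choice of \<open>u l\<close> makes \<open>c l\<close>
      true there, and also at \<open>\<nu>\<close>, since \<open>u l\<close> only involves variables
      below x_k.\<close>
    then have "sat \<nu> (c l)"
      using assms(9) l zero eval_restrict[of "u l" "k - 1" \<nu>] by (fastforce simp: zero_set_def)
    then show False
      using \<nu> l E_cases by blast
  qed
  have "f \<in> E"
    using A by (force simp: E_cases)
  moreover have "has_value k M g False" if "g \<in> E" "g \<noteq> f" for g
  proof -
    from \<open>g \<in> E\<close> consider a where "a \<in> A" "g = neg a" | l where "l \<in> {1..r}" "g = c l"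
      by (auto simp: E_cases)
    then show ?thesis
    proof cases
      case 1
      \<comment> \<open>Here \<open>a\<close> cannot be \<open>neg f\<close>, as \<open>g\<close>
        would then be \<open>neg (neg f) = f\<close>; so \<open>a\<close> comes from the
        trail.\<close>
      then have "a \<in> constraints M" "level a = k"
        using A \<open>g \<noteq> f\<close> by auto
      \<comment> \<open>Level \<open>k\<close> makes x_k occur in \<open>g\<close>, so its value is
        decided by \<open>neg g = a\<close> being on the trail, not by evaluation.\<close>
      then show ?thesis
        using 1 level_in_vars[OF _ \<open>1 \<le> k\<close>] M_polys by (intro refuted) auto
    next
      case 2
      \<comment> \<open>As x_k does not occur in \<open>c l\<close>, its value is the one under the
        partial assignment, where \<open>u l\<close> was chosen to violate it.\<close>
      have "pol g \<in> polys k" "k \<notin> vars (pol g)"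
        using c_polys[OF 2(1)] 2(2) polys_mono[of "k - 1" k] \<open>1 \<le> k\<close> by (auto simp: polys_def)
      moreover have "\<not> sat ?\<alpha> g"
        using assms(9) 2 by fastforce
      ultimately show ?thesis
        using evaluated[of g k M] by simp
    qed
  qed
  ultimately show ?thesis
    using clause valid unfolding explanation_clause_def valid_lemma_def justifies_def by blast
qed

end
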